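(* Let $c,d,e,f\in\mathbb{Z}[x]$, and for each integer $n\ge 1$ let $$M_n=\begin{pmatrix} c_n & d_n\\ e_n & f_n\end{pmatrix},\qquad c_n=c(n),\ d_n=d(n),\ e_n=e(n),\ f_n=f(n),$$ be a polynomial matrix (acting as a Möbius transform, so $\det M_n\neq 0$) satisfying $e_n\neq 0$ for all $n\ge 1$, for which the limit $\lim_{N\to\infty}\big[\prod_{n=1}^{N}M_n\big](\infty)$ exists. Then there exist a Möbius transform $T$ with entries in $\mathbb{Z}$ and polynomials $a',b'\in\mathbb{Z}[x]$ such that $$\lim_{N\to\infty}\Big[T\prod_{n=1}^{N}M_n\Big](\infty)=\mathbb{K}_{1}^{\infty}\frac{b'(n)}{a'(n)}.$$
   Context: A $2\times 2$ matrix $\begin{pmatrix} a&b\\ c&d\end{pmatrix}$ with nonzero determinant represents the Möbius transform $z\mapsto\frac{az+b}{cz+d}$ (with the usual conventions at $\infty$, e.g. $\infty\mapsto a/c$). Products $\prod_{n=1}^N M_n=M_1M_2\cdots M_N$ are taken in this order, and $[A](\infty)$ denotes the Möbius transform of the matrix $A$ evaluated at $\infty$. Limits are real numbers: a limit is said to exist when it exists in $\mathbb{R}$, and a value of $\infty$ counts as divergence. For sequences $(a_j)_{j\ge1},(b_j)_{j\ge1}$, the continued fraction $\mathbb{K}_1^\infty \frac{b_j}{a_j}=\cfrac{b_1}{a_1+\cfrac{b_2}{a_2+\cdots}}$ denotes $$\lim_{N\to\infty}\Big[\prod_{j=1}^{N}\begin{pmatrix}0&b_j\\1&a_j\end{pmatrix}\Big](0)=\lim_{N\to\infty}\Big[\prod_{j=1}^{N+1}\begin{pmatrix}0&b_j\\1&a_j\end{pmatrix}\Big](\infty).$$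 Thus $\mathbb{K}_{1}^{\infty}\frac{b'(n)}{a'(n)}$ is the continued fraction with partial numerators $b'(n)$ and partial denominators $a'(n)$, $n\ge 1$. A Möbius transform $T$ with entries in $\mathbb{Z}$ is given by an integer $2\times2$ matrix with nonzero determinant. *)

theory Defs
  imports "HOL-Analysis.Analysis" "HOL-Computational_Algebra.Polynomial"
begin

(* The projective line over the reals is modelled as "real option", with None as the point at
   infinity; it carries the one-point compactification topology of the real line. *)

definition mat2 :: "real \<Rightarrow> real \<Rightarrow> real \<Rightarrow> real \<Rightarrow> real^2^2" where
  "mat2 a b c d = vector [vector [a, b], vector [c, d]]"

(* Meaningful only for det A \<noteq> 0; then numerator and denominator never vanish together, so the
   value is None exactly at the pole. *)
definition moebius_act :: "real^2^2 \<Rightarrow> real option \<Rightarrow> real option" where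
  "moebius_act A z =
     (case z of
        None \<Rightarrow> if A$2$1 = 0 then None else Some (A$1$1 / A$2$1)
      | Some x \<Rightarrow> if A$2$1 * x + A$2$2 = 0 then None
                  else Some ((A$1$1 * x + A$1$2) / (A$2$1 * x + A$2$2)))"

primrec mat_prod :: "(nat \<Rightarrow> real^2^2) \<Rightarrow> nat \<Rightarrow> real^2^2" where
  "mat_prod M 0 = mat 1"
| "mat_prod M (Suc N) = mat_prod M N ** M (Suc N)"

(* The limit L is a real number; individual terms may be infinite. *)
definition tends_to_real :: "(nat \<Rightarrow> real option) \<Rightarrow> real \<Rightarrow> bool" where
  "tends_to_real X L \<longleftrightarrow>
     limitin (Alexandroff_compactification euclideanreal) X (Some L) sequentially"

lemma tends_to_real_iff:
  "tends_to_real X L \<longleftrightarrow>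
     (\<forall>\<^sub>F n in sequentially. X n \<noteq> None) \<and> (\<lambda>n. the (X n)) \<longlonglongrightarrow> L"
proof
  assume lim: "tends_to_real X L"
  have *: "\<forall>\<^sub>F n in sequentially. X n \<in> Some ` U" if "open U" "L \<in> U" for U
    using lim that unfolding tends_to_real_def limitin_def
    by (auto simp: openin_Alexandroff_compactification)
  have "\<forall>\<^sub>F n in sequentially. X n \<noteq> None"
    using *[of UNIV] by (auto elim: eventually_mono)
  moreover have "(\<lambda>n. the (X n)) \<longlonglongrightarrow> L"
  proof (rule topological_tendstoI)
    fix U assume "open U" "L \<in> U"
    from *[OF this] show "\<forall>\<^sub>F n in sequentially. the (X n) \<in> U"
      by (auto elim: eventually_mono)
  qed
  ultimately show "(\<forall>\<^sub>F n in sequentially. X n \<noteq> None) \<and> (\<lambda>n. the (X n)) \<longlonglongrightarrow> L"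
    by blast
next
  assume R: "(\<forall>\<^sub>F n in sequentially. X n \<noteq> None) \<and> (\<lambda>n. the (X n)) \<longlonglongrightarrow> L"
  have "\<forall>\<^sub>F n in sequentially. X n \<in> W"
    if W: "openin (Alexandroff_compactification euclideanreal) W" "Some L \<in> W" for W
  proof -
    have "open {x. Some x \<in> W}"
    proof -
      consider U where "open U" "W = Some ` U"
        | C where "closed C" "W = insert None (Some ` (- C))"
        using W(1) by (auto simp: openin_Alexandroff_compactification Compl_eq_Diff_UNIV)
      then show ?thesis
      proof cases
        case 1
        then have "{x. Some x \<in> W} = U" by auto
        with 1 show ?thesis by simp
      next
        case 2
        then have "{x. Some x \<in> W} = - C" by auto
        with 2 show ?thesis by (simp add: open_Compl)
      qed
    qed
    with W R have "\<forall>\<^sub>F n in sequentially. the (X n) \<in> {x. Some x \<in> W}"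
      by (metis mem_Collect_eq topological_tendstoD)
    with R have "\<forall>\<^sub>F n in sequentially. X n \<noteq> None \<and> the (X n) \<in> {x. Some x \<in> W}"
      by (simp add: eventually_conj)
    then show ?thesis by (rule eventually_mono) auto
  qed
  then show "tends_to_real X L"
    unfolding tends_to_real_def limitin_def by simp
qed

(* The continued fraction with partial numerators b j and partial denominators a j (j \<ge> 1)
   converges to the real number L. The factors act as Moebius transforms, so their determinants
   - b j must not vanish. *)
definition cont_frac_converges_to :: "(nat \<Rightarrow> real) \<Rightarrow> (nat \<Rightarrow> real) \<Rightarrow> real \<Rightarrow> bool" where
  "cont_frac_converges_to b a L \<longleftrightarrow>
     (\<forall>j\<ge>1. det (mat2 0 (b j) 1 (a j)) \<noteq> 0) \<and>
     tends_to_real (\<lambda>N. moebius_act (mat_prod (\<lambda>j. mat2 0 (b j) 1 (a j)) N) (Some 0)) L"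

lemma moebius_act_cont_frac_infinity:
  "moebius_act (mat_prod (\<lambda>j. mat2 0 (b j) 1 (a j)) (Suc N)) None =
   moebius_act (mat_prod (\<lambda>j. mat2 0 (b j) 1 (a j)) N) (Some 0)"
  by (simp add: moebius_act_def mat2_def matrix_matrix_mult_def sum_2)

definition poly_matrix ::
  "int poly \<Rightarrow> int poly \<Rightarrow> int poly \<Rightarrow> int poly \<Rightarrow> nat \<Rightarrow> real^2^2" where
  "poly_matrix c d e f n =
     mat2 (of_int (poly c (int n))) (of_int (poly d (int n)))
          (of_int (poly e (int n))) (of_int (poly f (int n)))"

end

theory Submission
  imports Defs
begin

text \<open>
  The first column of \<open>M\<^sub>1 \<cdots> M\<^sub>n\<close> obeys a second order recurrence with rational coefficients: the
  second column is eliminated between two consecutive steps, at the price of a division by \<open>e\<^sub>n\<close>.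
  Multiplying the column by \<open>e\<^sub>1 \<cdots> e\<^bsub>n-1\<^esub>\<close>, which does not change the point of the projective
  line that it represents, clears the denominators and leaves a recurrence
  \<open>u\<^bsub>n+2\<^esub> = A u\<^bsub>n+1\<^esub> + B u\<^sub>n\<close> whose coefficients are integer polynomials in \<open>n\<close>
  (\<open>scaled_column_recurrence\<close>).

  The convergents of a continued fraction are the solutions of its recurrence that start from
  \<open>(1,0)\<close>, \<open>(0,1)\<close>.  Fix a starting index \<open>k\<close>.  The linear map that takes \<open>u\<^sub>k, u\<^bsub>k+1\<^esub>\<close> to
  multiples of these two vectors by a common factor is the adjugate \<open>T\<close> of the matrix with columns
  \<open>u\<^sub>k, u\<^bsub>k+1\<^esub>\<close>; it has integer entries, and it turns the points \<open>[M\<^sub>1 \<cdots> M\<^sub>n](\<infinity>)\<close> into the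
  convergents of the continued fraction with shifted coefficients
  (\<open>adjugate_maps_recurrence_to_convergents\<close>).

  What remains is that \<open>T\<close> must not send the limit \<open>L\<close> to infinity.  The pole of \<open>T\<close> is the point
  represented by \<open>u\<^sub>k\<close>, and consecutive vectors \<open>u\<^sub>1, u\<^sub>2\<close> represent different points because
  they are independent, so one of \<open>k = 1\<close> and \<open>k = 2\<close> works.  Starting at
  \<open>k \<ge> 1\<close> rather than \<open>0\<close> also matters for the partial numerators, which contain the factor
  \<open>e\<^sub>k\<close>: nothing prevents \<open>e(0) = 0\<close>.
\<close>

section \<open>Points in homogeneous coordinates\<close>

definition proj_point :: "real \<Rightarrow> real \<Rightarrow> real option" where
  "proj_point x y = (if y = 0 then None else Some (x / y))"

lemma proj_point_scale:
  "k \<noteq> 0 \<Longrightarrow> proj_point (k * x) (k * y) = proj_point x y"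
  by (simp add: proj_point_def)

lemma moebius_act_None: "moebius_act A None = proj_point (A$1$1) (A$2$1)"
  by (simp add: moebius_act_def proj_point_def)

lemma moebius_act_zero: "moebius_act A (Some 0) = proj_point (A$1$2) (A$2$2)"
  by (simp add: moebius_act_def proj_point_def)

lemma mat2_nth [simp]:
  "mat2 a b c d $ 1 $ 1 = a" "mat2 a b c d $ 1 $ 2 = b"
  "mat2 a b c d $ 2 $ 1 = c" "mat2 a b c d $ 2 $ 2 = d"
  by (simp_all add: mat2_def)

lemma matrix_mult_2_nth:
  fixes A B :: "real^2^2"
  shows "(A ** B) $ i $ j = A$i$1 * B$1$j + A$i$2 * B$2$j"
  by (simp add: matrix_matrix_mult_def sum_2)

lemma tends_to_real_moebius:
  fixes T :: "real^2^2"
  assumes "tends_to_real (\<lambda>N. moebius_act (A N) None) L"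
    and "T$2$1 * L + T$2$2 \<noteq> 0"
  shows "tends_to_real (\<lambda>N. moebius_act (T ** A N) None)
           ((T$1$1 * L + T$1$2) / (T$2$1 * L + T$2$2))"
proof -
  define x where "x N = the (moebius_act (A N) None)" for N
  define y where "y N = (T$1$1 * x N + T$1$2) / (T$2$1 * x N + T$2$2)" for N
  have fin: "\<forall>\<^sub>F N in sequentially. moebius_act (A N) None \<noteq> None"
    and lim: "x \<longlonglongrightarrow> L"
    using assms(1) unfolding tends_to_real_iff x_def by auto
  have den: "(\<lambda>N. T$2$1 * x N + T$2$2) \<longlonglongrightarrow> T$2$1 * L + T$2$2"
    by (intro tendsto_intros lim)
  have y: "y \<longlonglongrightarrow> (T$1$1 * L + T$1$2) / (T$2$1 * L + T$2$2)"
    unfolding y_def by (intro tendsto_intros lim assms(2))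
  have "\<forall>\<^sub>F N in sequentially. T$2$1 * x N + T$2$2 \<noteq> 0"
    using tendsto_imp_eventually_ne[OF den assms(2)] .
  with fin have ev: "\<forall>\<^sub>F N in sequentially. moebius_act (T ** A N) None = Some (y N)"
  proof eventually_elim
    case (elim N)
    have q: "A N $2$1 \<noteq> 0" and xN: "x N = A N $1$1 / A N $2$1"
      using elim(1) by (auto simp: x_def moebius_act_None proj_point_def split: if_splits)
    have "A N $1$1 = A N $2$1 * x N" using q xN by simp
    then have "(T ** A N)$1$1 = A N $2$1 * (T$1$1 * x N + T$1$2)"
      and "(T ** A N)$2$1 = A N $2$1 * (T$2$1 * x N + T$2$2)"
      by (simp_all add: matrix_mult_2_nth algebra_simps)
    then show ?case
      using elim(2) q unfolding moebius_act_None
      by (simp add: proj_point_scale) (simp add: proj_point_def y_def)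
  qed
  have "\<forall>\<^sub>F N in sequentially. moebius_act (T ** A N) None \<noteq> None"
    using ev by eventually_elim simp
  moreover have "\<forall>\<^sub>F N in sequentially. y N = the (moebius_act (T ** A N) None)"
    using ev by eventually_elim simp
  ultimately show ?thesis
    unfolding tends_to_real_iff using y tendsto_cong by fastforce
qed

lemma tends_to_real_ignore_initial_segment:
  assumes "tends_to_real X L"
  shows "tends_to_real (\<lambda>N. X (N + k)) L"
  using assms LIMSEQ_ignore_initial_segment[of "\<lambda>n. the (X n)" L k]
    sequentially_offset[of "\<lambda>n. X n \<noteq> None" k]
  unfolding tends_to_real_iff by blast

section \<open>Recurrences and continued fractions\<close>

text \<open>Right multiplication by a continued fraction factor is one step of the recurrence, carried
  out on the matrix whose columns are two consecutive terms.\<close>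

lemma recurrence_eq_mat_prod:
  fixes x y a b :: "nat \<Rightarrow> real"
  assumes "\<And>n. x (n + 2) = a (n + 1) * x (n + 1) + b (n + 1) * x n"
    and "\<And>n. y (n + 2) = a (n + 1) * y (n + 1) + b (n + 1) * y n"
  shows "mat2 (x 0) (x 1) (y 0) (y 1) ** mat_prod (\<lambda>j. mat2 0 (b j) 1 (a j)) N
         = mat2 (x N) (x (N + 1)) (y N) (y (N + 1))"
proof (induction N)
  case 0
  show ?case by simp
next
  case (Suc N)
  have "mat2 (x 0) (x 1) (y 0) (y 1) ** mat_prod (\<lambda>j. mat2 0 (b j) 1 (a j)) (Suc N)
        = mat2 (x N) (x (N + 1)) (y N) (y (N + 1)) ** mat2 0 (b (Suc N)) 1 (a (Suc N))"
    using Suc.IH by (simp add: matrix_mul_assoc)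
  also have "\<dots> = mat2 (x (Suc N)) (x (Suc N + 1)) (y (Suc N)) (y (Suc N + 1))"
    using assms[of N] by (simp add: vec_eq_iff forall_2 matrix_mult_2_nth algebra_simps)
  finally show ?case .
qed

text \<open>Multiplying the previous matrix identity by the adjugate of the matrix of initial values
  leaves the matrix of convergents times the determinant.  The convergent evaluated at \<open>0\<close> is the
  second column, hence the index \<open>N + 1\<close> on the left.\<close>

lemma adjugate_maps_recurrence_to_convergents:
  fixes x y a b :: "nat \<Rightarrow> real"
  assumes "\<And>n. x (n + 2) = a (n + 1) * x (n + 1) + b (n + 1) * x n"
    and "\<And>n. y (n + 2) = a (n + 1) * y (n + 1) + b (n + 1) * y n"
    and det: "x 0 * y 1 - x 1 * y 0 \<noteq> 0"
  shows "proj_point (y 1 * x (N + 1) - x 1 * y (N + 1)) (x 0 * y (N + 1) - y 0 * x (N + 1))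
         = moebius_act (mat_prod (\<lambda>j. mat2 0 (b j) 1 (a j)) N) (Some 0)"
proof -
  define C where "C = mat_prod (\<lambda>j. mat2 0 (b j) 1 (a j)) N"
  define D where "D = x 0 * y 1 - x 1 * y 0"
  have eq: "mat2 (x 0) (x 1) (y 0) (y 1) ** C = mat2 (x N) (x (N + 1)) (y N) (y (N + 1))"
    unfolding C_def using assms(1,2) by (rule recurrence_eq_mat_prod)
  have X: "x (N + 1) = x 0 * C$1$2 + x 1 * C$2$2"
    using arg_cong[OF eq, of "\<lambda>A. A$1$2"] by (simp add: matrix_mult_2_nth)
  have Y: "y (N + 1) = y 0 * C$1$2 + y 1 * C$2$2"
    using arg_cong[OF eq, of "\<lambda>A. A$2$2"] by (simp add: matrix_mult_2_nth)
  have "y 1 * x (N + 1) - x 1 * y (N + 1) = D * C$1$2"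
    and "x 0 * y (N + 1) - y 0 * x (N + 1) = D * C$2$2"
    unfolding X Y D_def by (simp_all add: algebra_simps)
  then show ?thesis
    using det unfolding C_def[symmetric] moebius_act_zero
    by (simp add: proj_point_scale D_def)
qed

section \<open>The recurrence for a product of matrices\<close>

text \<open>Row \<open>i\<close> of the first column of the product, with the denominators of its recurrence
  cleared.\<close>

definition scaled_column :: "(nat \<Rightarrow> real^2^2) \<Rightarrow> 2 \<Rightarrow> nat \<Rightarrow> real" where
  "scaled_column M i n = (\<Prod>j=1..<n. M j $2$1) * mat_prod M n $i$1"

text \<open>The index starts at \<open>1\<close> because the factor \<open>e\<^sub>n\<close> is gained in the step from \<open>n\<close> to
  \<open>n + 1\<close> only from there on.\<close>

lemma scaled_column_recurrence:
  assumes "n \<ge> 1"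
  shows "scaled_column M i (n + 2) =
      (M (n + 2) $1$1 * M (n + 1) $2$1 + M (n + 2) $2$1 * M (n + 1) $2$2) * scaled_column M i (n + 1)
      + (- (M (n + 2) $2$1 * M n $2$1 * det (M (n + 1)))) * scaled_column M i n"
proof -
  have "(\<Prod>j=1..<n+1. M j $2$1) = (\<Prod>j=1..<n. M j $2$1) * M n $2$1"
    and "(\<Prod>j=1..<n+2. M j $2$1) = (\<Prod>j=1..<n. M j $2$1) * M n $2$1 * M (n + 1) $2$1"
    using assms by simp_all
  moreover have "M (n + 1) $2$1 * mat_prod M (n + 2) $i$1 =
      (M (n + 2) $1$1 * M (n + 1) $2$1 + M (n + 2) $2$1 * M (n + 1) $2$2) * mat_prod M (n + 1) $i$1
      - M (n + 2) $2$1 * det (M (n + 1)) * mat_prod M n $i$1"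
    by (simp add: matrix_mult_2_nth det_2 algebra_simps)
  ultimately show ?thesis
    unfolding scaled_column_def by algebra
qed

lemma det_mat_prod: "det (mat_prod M N) = (\<Prod>n=1..N. det (M n))"
  by (induction N) (simp_all add: det_mul)

lemma scaled_column_independent:
  assumes "n \<ge> 1"
    and det: "\<And>n. n \<ge> 1 \<Longrightarrow> det (M n) \<noteq> 0"
    and e: "\<And>n. n \<ge> 1 \<Longrightarrow> M n $2$1 \<noteq> 0"
  shows "scaled_column M 1 n * scaled_column M 2 (n + 1)
         - scaled_column M 1 (n + 1) * scaled_column M 2 n \<noteq> 0"
proof -
  have "scaled_column M 1 n * scaled_column M 2 (n + 1)
        - scaled_column M 1 (n + 1) * scaled_column M 2 n
      = (\<Prod>j=1..<n. M j $2$1) * (\<Prod>j=1..<n+1. M j $2$1) * M (n + 1) $2$1 * det (mat_prod M n)"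
    unfolding scaled_column_def
    by (simp add: matrix_mult_2_nth det_2 algebra_simps)
  then show ?thesis
    using det e by (simp add: det_mat_prod)
qed

lemma moebius_act_scaled_column:
  fixes T :: "real^2^2"
  assumes e: "\<And>n. n \<ge> 1 \<Longrightarrow> M n $2$1 \<noteq> 0"
  shows "proj_point (T$1$1 * scaled_column M 1 n + T$1$2 * scaled_column M 2 n)
                    (T$2$1 * scaled_column M 1 n + T$2$2 * scaled_column M 2 n)
         = moebius_act (T ** mat_prod M n) None"
proof -
  let ?w = "\<Prod>j=1..<n. M j $2$1"
  have "?w \<noteq> 0" using e by simp
  moreover have "T$i$1 * scaled_column M 1 n + T$i$2 * scaled_column M 2 n
      = ?w * (T ** mat_prod M n)$i$1" for i
    by (simp add: scaled_column_def matrix_mult_2_nth algebra_simps)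
  ultimately show ?thesis
    by (simp add: proj_point_scale moebius_act_None)
qed

lemma mat_prod_in_Ints:
  assumes "\<And>n i j. M n $i$j \<in> \<int>"
  shows "mat_prod M N $i$j \<in> \<int>"
  using assms
  by (induction N arbitrary: i j) (auto simp: mat_def matrix_mult_2_nth)

lemma scaled_column_in_Ints:
  assumes "\<And>n i j. M n $i$j \<in> \<int>"
  shows "scaled_column M i n \<in> \<int>"
  unfolding scaled_column_def
  by (intro Ints_mult Ints_prod mat_prod_in_Ints assms)

section \<open>Matrices with polynomial entries\<close>

lemma poly_matrix_nth [simp]:
  "poly_matrix c d e f n $ 1 $ 1 = of_int (poly c (int n))"
  "poly_matrix c d e f n $ 1 $ 2 = of_int (poly d (int n))"
  "poly_matrix c d e f n $ 2 $ 1 = of_int (poly e (int n))"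
  "poly_matrix c d e f n $ 2 $ 2 = of_int (poly f (int n))"
  by (simp_all add: poly_matrix_def)

lemma poly_matrix_in_Ints: "poly_matrix c d e f n $ i $ j \<in> \<int>"
  using exhaust_2[of i] exhaust_2[of j] by auto

definition shift_poly :: "nat \<Rightarrow> int poly \<Rightarrow> int poly" where
  "shift_poly k p = pcompose p [:int k, 1:]"

lemma poly_shift_poly: "poly (shift_poly k p) (int n) = poly p (int (n + k))"
  by (simp add: shift_poly_def poly_pcompose add.commute)

theorem theorem1:
  fixes c d e f :: "int poly"
  assumes "\<And>n. n \<ge> 1 \<Longrightarrow> det (poly_matrix c d e f n) \<noteq> 0"
    and "\<And>n::nat. n \<ge> 1 \<Longrightarrow> poly e (int n) \<noteq> 0"
    and "\<exists>L. tends_to_real (\<lambda>N. moebius_act (mat_prod (poly_matrix c d e f) N) None) L"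
  shows "\<exists>(T :: real^2^2) (a' :: int poly) (b' :: int poly).
           (\<forall>i j. T$i$j \<in> \<int>) \<and> det T \<noteq> 0 \<and>
           (\<exists>K. tends_to_real
                  (\<lambda>N. moebius_act (T ** mat_prod (poly_matrix c d e f) N) None) K \<and>
                cont_frac_converges_to
                  (\<lambda>n. of_int (poly b' (int n))) (\<lambda>n. of_int (poly a' (int n))) K)"
proof -
  define M where "M = poly_matrix c d e f"
  define u where "u = scaled_column M"
  obtain L where L: "tends_to_real (\<lambda>N. moebius_act (mat_prod M N) None) L"
    using assms(3) unfolding M_def by blast
  have det: "det (M n) \<noteq> 0" if "n \<ge> 1" for n
    using assms(1) that unfolding M_def by blast
  have e: "M n $2$1 \<noteq> 0" if "n \<ge> 1" for n
    using assms(2) that unfolding M_def by simp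
  have indep: "u 1 n * u 2 (n + 1) - u 1 (n + 1) * u 2 n \<noteq> 0" if "n \<ge> 1" for n
    using scaled_column_independent[of n M] det e that unfolding u_def by blast

  \<comment> \<open>If \<open>u\<^sub>1\<close> and \<open>u\<^sub>2\<close> both represented \<open>L\<close>, they would be dependent.\<close>
  obtain k where k: "k \<ge> 1" and finite_value: "- u 2 k * L + u 1 k \<noteq> 0"
  proof (cases "- u 2 1 * L + u 1 1 = 0")
    case True
    have "- u 2 2 * L + u 1 2 \<noteq> 0"
    proof
      assume "- u 2 2 * L + u 1 2 = 0"
      with True have "u 1 1 = u 2 1 * L" "u 1 2 = u 2 2 * L" by simp_all
      with indep[of 1] show False by (simp add: numeral_2_eq_2)
    qed
    then show ?thesis using that[of 2] by simp
  next
    case False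
    then show ?thesis using that[of 1] by simp
  qed

  define a' where "a' = shift_poly (k + 1) c * shift_poly k e + shift_poly (k + 1) e * shift_poly k f"
  \<comment> \<open>Since \<open>k \<ge> 1\<close>, the index \<open>k - 1\<close> is no truncation; it makes \<open>b'(1)\<close> contain \<open>e(k)\<close>.\<close>
  define b' where "b' = - (shift_poly (k + 1) e * shift_poly (k - 1) e
      * (shift_poly k c * shift_poly k f - shift_poly k d * shift_poly k e))"
  define a where "a n = real_of_int (poly a' (int n))" for n
  define b where "b n = real_of_int (poly b' (int n))" for n
  have a_eq: "a n = M (n + k + 1) $1$1 * M (n + k) $2$1 + M (n + k + 1) $2$1 * M (n + k) $2$2" for n
    unfolding a_def a'_def M_def by (simp add: poly_shift_poly del: of_nat_add of_nat_Suc)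
  have b_eq: "b n = - (M (n + k + 1) $2$1 * M (n + (k - 1)) $2$1 * det (M (n + k)))" for n
    unfolding b_def b'_def M_def by (simp add: poly_shift_poly det_2 del: of_nat_add of_nat_Suc)
  have rec: "u i (n + 2 + k) = a (n + 1) * u i (n + 1 + k) + b (n + 1) * u i (n + k)" for i n
    using scaled_column_recurrence[of "n + k" M i] k
    unfolding u_def a_eq b_eq by (simp add: ac_simps)
  have b_nz: "b n \<noteq> 0" if "n \<ge> 1" for n
    using det[of "n + k"] e[of "n + k + 1"] e[of "n + (k - 1)"] that unfolding b_eq by simp

  define T where "T = mat2 (u 2 (k + 1)) (- u 1 (k + 1)) (- u 2 k) (u 1 k)"
  define K where "K = (T$1$1 * L + T$1$2) / (T$2$1 * L + T$2$2)"
  have u_Int: "u i n \<in> \<int>" for i n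
    unfolding u_def M_def by (intro scaled_column_in_Ints poly_matrix_in_Ints)
  have T_Int: "\<forall>i j. T$i$j \<in> \<int>"
    unfolding T_def forall_2 by (simp add: u_Int Ints_minus)
  have T_det: "det T \<noteq> 0"
    using indep[OF k] unfolding T_def by (simp add: det_2 algebra_simps)
  have lim: "tends_to_real (\<lambda>N. moebius_act (T ** mat_prod M N) None) K"
    unfolding K_def using L finite_value
    by (intro tends_to_real_moebius) (simp_all add: T_def)

  have "moebius_act (mat_prod (\<lambda>j. mat2 0 (b j) 1 (a j)) N) (Some 0)
        = moebius_act (T ** mat_prod M (N + (k + 1))) None" for N
  proof -
    have "moebius_act (mat_prod (\<lambda>j. mat2 0 (b j) 1 (a j)) N) (Some 0)
        = proj_point (u 2 (1 + k) * u 1 (N + 1 + k) - u 1 (1 + k) * u 2 (N + 1 + k))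
                     (u 1 (0 + k) * u 2 (N + 1 + k) - u 2 (0 + k) * u 1 (N + 1 + k))"
      using indep[OF k] rec
      by (intro adjugate_maps_recurrence_to_convergents[symmetric,
            where x = "\<lambda>n. u 1 (n + k)" and y = "\<lambda>n. u 2 (n + k)"]) (simp_all add: add.commute)
    also have "\<dots> = moebius_act (T ** mat_prod M (N + (k + 1))) None"
      using moebius_act_scaled_column[of M T "N + (k + 1)"] e
      unfolding u_def[symmetric] T_def by (simp add: ac_simps)
    finally show ?thesis .
  qed
  then have "cont_frac_converges_to b a K"
    using tends_to_real_ignore_initial_segment[OF lim, of "k + 1"] b_nz
    unfolding cont_frac_converges_to_def by (simp add: det_2)
  then have "cont_frac_converges_to (\<lambda>n. of_int (poly b' (int n))) (\<lambda>n. of_int (poly a' (int n))) K"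
    unfolding a_def b_def .
  with T_Int T_det lim show ?thesis
    unfolding M_def by blast
qed

end
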